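(* Let $(X,\tau)$ be a locally convex Hausdorff topological vector space over $\mathbb{K}\in\{\mathbb{R},\mathbb{C}\}$. Then $X$ is countably separated if and only if there is a metrizable topology $\rho$ on $X$ that is coarser than $\tau$ (i.e. $\rho\subseteq\tau$). Moreover, in this case $\rho$ can be chosen to be a locally convex vector space topology (still metrizable and coarser than $\tau$).
   Context: $X'$ denotes the continuous dual of $X$. A null neighborhood is a neighborhood of the origin. For $A\subseteq X$ the polar is $A^\circ=\{x'\in X' : \operatorname{Re}\langle x',x\rangle\le 1 \text{ for all } x\in A\}$, and for $B\subseteq X'$ and $x\in X$ the support function is $S(B,x)=\sup_{x'\in B}\operatorname{Re}\langle x',x\rangle$ (real parts are superfluous if $\mathbb{K}=\mathbb{R}$). A locally convex Hausdorff space $X$ is called countably separated if there is a sequence $(U_n)_{n\ge1}$ of absolutely convex, closed null neighborhoods in $X$ with $\bigcap_{n\ge 1}\{x\in X : S(U_n^\circ,x)=0\}=\{0\}$. "Coarser" is meant in the non-strict sense. *)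

theory Defs
  imports "HOL-Analysis.Analysis"
begin

text \<open>The scalar fields: \<open>\<real>\<close> and \<open>\<complex>\<close>, up to an isometric field isomorphism. The embedding \<open>e\<close> below is
  unique up to complex conjugation, so that \<open>re_part\<close> is determined.\<close>

class real_or_complex = real_normed_field +
  fixes re_part :: "'a \<Rightarrow> real"
  assumes ex_complex_embedding:
    "\<exists>e :: 'a \<Rightarrow> complex.
       (\<forall>x y. e (x + y) = e x + e y) \<and> (\<forall>x y. e (x * y) = e x * e y) \<and> e 1 = 1 \<and>
       (\<forall>x. norm (e x) = norm x) \<and> (range e = \<real> \<or> range e = UNIV) \<and>
       (\<forall>x. re_part x = Re (e x))"

instantiation real :: real_or_complex
begin
definition re_part_real :: "real \<Rightarrow> real" where "re_part_real x = x"
instance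
  by standard (rule exI[of _ complex_of_real], auto simp: re_part_real_def Reals_def)
end

instantiation complex :: real_or_complex
begin
definition re_part_complex :: "complex \<Rightarrow> real" where "re_part_complex = Re"
instance
  by standard (rule exI[of _ "\<lambda>x. x"], auto simp: re_part_complex_def)
end

definition vector_space_topology ::
    "('k::real_normed_field \<Rightarrow> 'a::ab_group_add \<Rightarrow> 'a) \<Rightarrow> 'a topology \<Rightarrow> bool" where
  "vector_space_topology scal \<tau> \<longleftrightarrow>
     topspace \<tau> = UNIV \<and>
     continuous_map (prod_topology \<tau> \<tau>) \<tau> (\<lambda>(x, y). x + y) \<and>
     continuous_map (prod_topology euclidean \<tau>) \<tau> (\<lambda>(c, x). scal c x)"

definition null_neighborhood :: "'a::zero topology \<Rightarrow> 'a set \<Rightarrow> bool" where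
  "null_neighborhood \<tau> U \<longleftrightarrow> (\<exists>W. openin \<tau> W \<and> 0 \<in> W \<and> W \<subseteq> U)"

text \<open>The library's \<open>convex\<close> is tied to the class \<^class>\<open>real_vector\<close>; here the real scalars act
  through \<^const>\<open>of_real\<close>.\<close>

definition convex_wrt ::
    "('k::real_normed_field \<Rightarrow> 'a::ab_group_add \<Rightarrow> 'a) \<Rightarrow> 'a set \<Rightarrow> bool" where
  "convex_wrt scal A \<longleftrightarrow>
     (\<forall>x\<in>A. \<forall>y\<in>A. \<forall>u v :: real. 0 \<le> u \<longrightarrow> 0 \<le> v \<longrightarrow> u + v = 1 \<longrightarrow>
        scal (of_real u) x + scal (of_real v) y \<in> A)"

definition absolutely_convex ::
    "('k::real_normed_field \<Rightarrow> 'a::ab_group_add \<Rightarrow> 'a) \<Rightarrow> 'a set \<Rightarrow> bool" where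
  "absolutely_convex scal A \<longleftrightarrow>
     convex_wrt scal A \<and> (\<forall>x\<in>A. \<forall>c. norm c \<le> 1 \<longrightarrow> scal c x \<in> A)"

definition locally_convex_topology ::
    "('k::real_normed_field \<Rightarrow> 'a::ab_group_add \<Rightarrow> 'a) \<Rightarrow> 'a topology \<Rightarrow> bool" where
  "locally_convex_topology scal \<tau> \<longleftrightarrow>
     vector_space_topology scal \<tau> \<and>
     (\<forall>U. null_neighborhood \<tau> U \<longrightarrow>
        (\<exists>V. null_neighborhood \<tau> V \<and> convex_wrt scal V \<and> V \<subseteq> U))"

definition continuous_dual ::
    "('k::real_normed_field \<Rightarrow> 'a::ab_group_add \<Rightarrow> 'a) \<Rightarrow> 'a topology \<Rightarrow> ('a \<Rightarrow> 'k) set" where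
  "continuous_dual scal \<tau> =
     {f. Vector_Spaces.linear scal (*) f \<and> continuous_map \<tau> euclidean f}"

definition polar ::
    "('k::real_or_complex \<Rightarrow> 'a::ab_group_add \<Rightarrow> 'a) \<Rightarrow> 'a topology \<Rightarrow> 'a set \<Rightarrow> ('a \<Rightarrow> 'k) set" where
  "polar scal \<tau> A = {f \<in> continuous_dual scal \<tau>. \<forall>x\<in>A. re_part (f x) \<le> 1}"

text \<open>Extended real values, since the supremum may be infinite.\<close>

definition support_function :: "('a \<Rightarrow> 'k::real_or_complex) set \<Rightarrow> 'a \<Rightarrow> ereal" where
  "support_function B x = (SUP f\<in>B. ereal (re_part (f x)))"

definition countably_separated ::
    "('k::real_or_complex \<Rightarrow> 'a::ab_group_add \<Rightarrow> 'a) \<Rightarrow> 'a topology \<Rightarrow> bool" where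
  "countably_separated scal \<tau> \<longleftrightarrow>
     (\<exists>U :: nat \<Rightarrow> 'a set.
        (\<forall>n. absolutely_convex scal (U n) \<and> closedin \<tau> (U n) \<and> null_neighborhood \<tau> (U n)) \<and>
        (\<Inter>n. {x. support_function (polar scal \<tau> (U n)) x = 0}) = {0})"

definition coarser :: "'a topology \<Rightarrow> 'a topology \<Rightarrow> bool" where
  "coarser \<rho> \<tau> \<longleftrightarrow> (\<forall>U. openin \<rho> U \<longrightarrow> openin \<tau> U)"

end

theory Submission
  imports Defs
begin

text \<open>The bridge between absolutely convex null neighborhoods and metrics is the Minkowski functional: that
of an absolutely convex null neighborhood \<open>U\<close> is a continuous seminorm \<open>p\<close> with
\<open>{p < 1} \<subseteq> U \<subseteq> {p \<le> 1}\<close>.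

From separation to a metric. If \<open>p\<^sub>n x = 0\<close> for the Minkowski functional of \<open>U\<^sub>n\<close>, then all positive
multiples of \<open>x\<close> lie in \<open>U\<^sub>n\<close>, so every functional in the polar has real part at most \<open>0\<close> at \<open>x\<close>, and the
support function vanishes there. A separating sequence of neighborhoods thus yields a sequence of
continuous seminorms whose only common zero is \<open>0\<close>. The translation-invariant metric
\<open>d (x, y) = sup\<^sub>n min (2\<^sup>-\<^sup>n, p\<^sub>n (x - y))\<close> then works. Taking the supremum rather than the usual sum over \<open>n\<close>
makes the balls convex, so local convexity is immediate; and each ball contains a finite intersection
of balls of the \<open>p\<^sub>n\<close>, so the metric topology is coarser than the given one
(\<open>countably_separated_imp_metrizable\<close>).

From a metric to separation. The balls of radius \<open>1/(n+1)\<close> around \<open>0\<close> of a coarser metric are null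
neighborhoods with intersection \<open>{0}\<close>. Local convexity puts an absolutely convex null neighborhood \<open>D\<^sub>n\<close> into the \<open>n\<close>-th ball, and \<open>U\<^sub>n\<close> is
the closed unit ball of its Minkowski functional \<open>p\<^sub>n\<close>. If \<open>p\<^sub>n x > 0\<close>, the Hahn-Banach theorem
gives a functional \<open>f\<close> with \<open>\<bar>f\<bar> \<le> p\<^sub>n\<close> and \<open>f x\<close> of real part \<open>p\<^sub>n x\<close>; it lies in the polar of \<open>U\<^sub>n\<close>, and the
support function is positive at \<open>x\<close>. So a common zero of the support functions is a common zero of the
\<open>p\<^sub>n\<close> and lies in every ball (\<open>countably_separatedI\<close>).

The Hahn-Banach theorem is proved through minimal sublinear functions: by Zorn's lemma there is
a minimal one below a given sublinear function, and minimality forces it to be linear. Over a complex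
scalar field, the real-linear functional \<open>u\<close> so obtained is the real part of the complex-linear functional
\<open>x \<mapsto> u x - \<i> u (\<i> x)\<close>.\<close>
section \<open>Linear functionals dominated by a sublinear function\<close>

definition sublinear_wrt :: "(real \<Rightarrow> 'a::ab_group_add \<Rightarrow> 'a) \<Rightarrow> ('a \<Rightarrow> real) \<Rightarrow> bool" where
  "sublinear_wrt s q \<longleftrightarrow>
     (\<forall>x y. q (x + y) \<le> q x + q y) \<and> (\<forall>r x. 0 \<le> r \<longrightarrow> q (s r x) = r * q x)"

text \<open>The largest sublinear function \<open>g \<le> q\<close> with \<open>g (- a) \<le> - q a\<close>: the one that is forced to be as small as
possible in the direction \<open>- a\<close>. It is the tool for making a sublinear function smaller wherever it
fails to be linear.\<close>
definition tilt :: "(real \<Rightarrow> 'a::ab_group_add \<Rightarrow> 'a) \<Rightarrow> ('a \<Rightarrow> real) \<Rightarrow> 'a \<Rightarrow> 'a \<Rightarrow> real" where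
  "tilt s q a x = (INF t\<in>{0..}. q (x + s t a) - t * q a)"

locale real_scaling = vector_space s for s :: "real \<Rightarrow> 'a::ab_group_add \<Rightarrow> 'a"
begin

text \<open>An inequality suffices in the homogeneity condition because it can be applied to \<open>r\<close> and \<open>1/r\<close>.\<close>
lemma sublinear_wrtI:
  assumes add: "\<And>x y. q (x + y) \<le> q x + q y"
    and pos: "\<And>r x. 0 < r \<Longrightarrow> q (s r x) \<le> r * q x"
  shows "sublinear_wrt s q"
proof -
  have eq: "q (s r x) = r * q x" if r: "0 < r" for r x
  proof (rule antisym)
    have "q x = q (s (1/r) (s r x))" using r by simp
    also have "\<dots> \<le> (1/r) * q (s r x)" using r by (intro pos) simp
    finally show "r * q x \<le> q (s r x)" using r by (simp add: field_simps)
  qed (rule pos[OF r])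
  have "q 0 = 2 * q 0" using eq[of 2 0] by simp
  then have "q 0 = 0" by simp
  then have "q (s r x) = r * q x" if "0 \<le> r" for r x
    using eq[of r x] that by (cases "r = 0") auto
  then show ?thesis using add by (auto simp: sublinear_wrt_def)
qed

lemma
  assumes "sublinear_wrt s q"
  shows sublinear_add: "q (x + y) \<le> q x + q y"
    and sublinear_scale: "0 \<le> r \<Longrightarrow> q (s r x) = r * q x"
    and sublinear_0: "q 0 = 0"
    and sublinear_minus: "- q (- x) \<le> q x"
proof -
  show add: "q (x + y) \<le> q x + q y" for x y
    using assms by (simp add: sublinear_wrt_def)
  show sc: "0 \<le> r \<Longrightarrow> q (s r x) = r * q x" for r x
    using assms by (simp add: sublinear_wrt_def)
  show "q 0 = 0" using sc[of 0 0] by simp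
  then show "- q (- x) \<le> q x" using add[of x "- x"] by simp
qed

text \<open>Bounds the infimum from below, so that it is a genuine real number.\<close>
lemma tilt_term_bound:
  assumes q: "sublinear_wrt s q" and t: "0 \<le> t"
  shows "- q (- x) \<le> q (x + s t a) - t * q a"
proof -
  have "t * q a = q (- x + (x + s t a))" using sublinear_scale[OF q t] by simp
  also have "\<dots> \<le> q (- x) + q (x + s t a)" by (rule sublinear_add[OF q])
  finally show ?thesis by simp
qed

lemma tilt_le:
  assumes q: "sublinear_wrt s q" and t: "0 \<le> t"
  shows "tilt s q a x \<le> q (x + s t a) - t * q a"
  unfolding tilt_def
proof (rule cINF_lower)
  show "bdd_below ((\<lambda>t. q (x + s t a) - t * q a) ` {0..})"
    by (rule bdd_belowI2[of _ "- q (- x)"]) (use tilt_term_bound[OF q] in auto)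
qed (use t in auto)

lemma le_tilt:
  assumes "\<And>t. 0 \<le> t \<Longrightarrow> b \<le> q (x + s t a) - t * q a"
  shows "b \<le> tilt s q a x"
  unfolding tilt_def by (rule cINF_greatest) (use assms in auto)

lemma tilt_le_self: "sublinear_wrt s q \<Longrightarrow> tilt s q a x \<le> q x"
  using tilt_le[of q 0 a x] by simp

lemma sublinear_tilt:
  assumes q: "sublinear_wrt s q"
  shows "sublinear_wrt s (tilt s q a)"
proof (rule sublinear_wrtI)
  fix x y
  have "tilt s q a (x + y) - tilt s q a y \<le> q (x + s t a) - t * q a" if t: "0 \<le> t" for t
  proof -
    have "tilt s q a (x + y) - (q (x + s t a) - t * q a) \<le> q (y + s t' a) - t' * q a"
      if t': "0 \<le> t'" for t'
    proof -
      have "tilt s q a (x + y) \<le> q ((x + y) + s (t + t') a) - (t + t') * q a"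
        using t t' by (intro tilt_le[OF q]) simp
      also have "(x + y) + s (t + t') a = (x + s t a) + (y + s t' a)"
        by (simp add: scale_left_distrib)
      also have "q \<dots> \<le> q (x + s t a) + q (y + s t' a)" by (rule sublinear_add[OF q])
      finally show ?thesis by (simp add: algebra_simps)
    qed
    then have "tilt s q a (x + y) - (q (x + s t a) - t * q a) \<le> tilt s q a y"
      by (rule le_tilt)
    then show ?thesis by simp
  qed
  then have "tilt s q a (x + y) - tilt s q a y \<le> tilt s q a x"
    by (rule le_tilt)
  then show "tilt s q a (x + y) \<le> tilt s q a x + tilt s q a y" by simp
next
  fix r :: real and x assume r: "0 < r"
  have "tilt s q a (s r x) / r \<le> q (x + s t a) - t * q a" if t: "0 \<le> t" for t
  proof -
    have "tilt s q a (s r x) \<le> q (s r x + s (r * t) a) - r * t * q a"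
      using r t by (intro tilt_le[OF q]) simp
    also have "s r x + s (r * t) a = s r (x + s t a)" by (simp add: scale_right_distrib)
    also have "q \<dots> = r * q (x + s t a)" using r by (intro sublinear_scale[OF q]) simp
    finally show ?thesis using r by (simp add: field_simps)
  qed
  then have "tilt s q a (s r x) / r \<le> tilt s q a x" by (rule le_tilt)
  then show "tilt s q a (s r x) \<le> r * tilt s q a x" using r by (simp add: field_simps)
qed

text \<open>Subadditivity survives the infimum because two members of a chain can be replaced by the smaller one;
for an arbitrary family it would fail.\<close>
lemma sublinear_INF_chain:
  assumes sub: "\<And>q. q \<in> C \<Longrightarrow> sublinear_wrt s q" and ne: "C \<noteq> {}"
    and bdd: "\<And>x. bdd_below ((\<lambda>q. q x) ` C)"
    and chain: "\<And>q q'. q \<in> C \<Longrightarrow> q' \<in> C \<Longrightarrow> (\<forall>x. q x \<le> q' x) \<or> (\<forall>x. q' x \<le> q x)"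
  shows "sublinear_wrt s (\<lambda>x. INF q\<in>C. q x)"
proof (rule sublinear_wrtI)
  have low: "(INF q\<in>C. q x) \<le> q x" if "q \<in> C" for q x
    by (rule cINF_lower[OF bdd that])
  fix x y
  let ?m = "\<lambda>x. INF q\<in>C. q x"
  have *: "?m (x + y) \<le> q x + q' y" if "q \<in> C" "q' \<in> C" for q q'
    using chain[OF that]
  proof
    assume "\<forall>x. q x \<le> q' x"
    then show ?thesis
      using low[OF that(1), of "x + y"] sublinear_add[OF sub[OF that(1)], of x y]
      by (smt (verit))
  next
    assume "\<forall>x. q' x \<le> q x"
    then show ?thesis
      using low[OF that(2), of "x + y"] sublinear_add[OF sub[OF that(2)], of x y]
      by (smt (verit))
  qed
  have "?m (x + y) - ?m y \<le> q x" if q: "q \<in> C" for q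
  proof -
    have "?m (x + y) - q x \<le> ?m y"
      by (rule cINF_greatest[OF ne]) (use *[OF q] in \<open>simp add: algebra_simps\<close>)
    then show ?thesis by simp
  qed
  then have "?m (x + y) - ?m y \<le> ?m x" by (rule cINF_greatest[OF ne])
  then show "?m (x + y) \<le> ?m x + ?m y" by simp
next
  have low: "(INF q\<in>C. q x) \<le> q x" if "q \<in> C" for q x
    by (rule cINF_lower[OF bdd that])
  fix r :: real and x assume r: "0 < r"
  have "(INF q\<in>C. q (s r x)) / r \<le> q x" if q: "q \<in> C" for q
    using low[OF q, of "s r x"] sublinear_scale[OF sub[OF q], of r x] r
    by (simp add: field_simps)
  then have "(INF q\<in>C. q (s r x)) / r \<le> (INF q\<in>C. q x)" by (rule cINF_greatest[OF ne])
  then show "(INF q\<in>C. q (s r x)) \<le> r * (INF q\<in>C. q x)" using r by (simp add: field_simps)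
qed

text \<open>Zorn's lemma for the reversed pointwise order. A chain below \<open>p\<close> is bounded from below at \<open>x\<close> by
\<open>- p (- x)\<close>.\<close>
lemma ex_minimal_sublinear:
  assumes p: "sublinear_wrt s p"
  obtains u where "sublinear_wrt s u" "\<And>x. u x \<le> p x"
    "\<And>q. sublinear_wrt s q \<Longrightarrow> (\<And>x. q x \<le> u x) \<Longrightarrow> q = u"
proof -
  define A where "A = {q. sublinear_wrt s q \<and> (\<forall>x. q x \<le> p x)}"
  define P :: "('a \<Rightarrow> real) \<Rightarrow> ('a \<Rightarrow> real) \<Rightarrow> bool" where "P q q' \<longleftrightarrow> (\<forall>x. q' x \<le> q x)" for q q'
  have "\<exists>m\<in>A. \<forall>q\<in>A. P m q \<longrightarrow> q = m"
  proof (rule predicate_Zorn)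
    show "partial_order_on A (relation_of P A)"
    proof (rule partial_order_on_relation_ofI)
      show "P q q" if "q \<in> A" for q by (simp add: P_def)
      show "P q1 q3" if "P q1 q2" "P q2 q3" for q1 q2 q3
        using that by (auto simp: P_def intro: order_trans)
      show "q1 = q2" if "P q1 q2" "P q2 q1" for q1 q2
        using that by (auto simp: P_def intro!: ext antisym)
    qed
  next
    fix C assume C: "C \<in> Chains (relation_of P A)"
    show "\<exists>u\<in>A. \<forall>q\<in>C. P q u"
    proof (cases "C = {}")
      case True
      then show ?thesis using p by (auto simp: A_def)
    next
      case False
      have CA: "q \<in> A" if "q \<in> C" for q
        using C that by (auto simp: Chains_def relation_of_def)
      have sub: "sublinear_wrt s q" and le: "q x \<le> p x" if "q \<in> C" for q x
        using CA[OF that] by (auto simp: A_def)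
      have bdd: "bdd_below ((\<lambda>q. q x) ` C)" for x
      proof (rule bdd_belowI2)
        fix q assume "q \<in> C"
        then show "- p (- x) \<le> q x"
          using sublinear_minus[OF sub, of q x] le[of q "- x"] by simp
      qed
      define m where "m = (\<lambda>x. INF q\<in>C. q x)"
      have low: "m x \<le> q x" if "q \<in> C" for q x
        unfolding m_def by (rule cINF_lower[OF bdd that])
      have "sublinear_wrt s m"
        unfolding m_def using sub False bdd
      proof (rule sublinear_INF_chain)
        show "(\<forall>x. q x \<le> q' x) \<or> (\<forall>x. q' x \<le> q x)" if "q \<in> C" "q' \<in> C" for q q'
          using C that by (auto simp: Chains_def relation_of_def P_def)
      qed
      moreover from False obtain q where "q \<in> C" by auto
      then have "m x \<le> p x" for x using low le order_trans by blast
      ultimately have "m \<in> A" by (simp add: A_def)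
      then show ?thesis using low by (auto simp: P_def)
    qed
  qed
  then obtain u where u: "u \<in> A" "\<And>q. q \<in> A \<Longrightarrow> P u q \<Longrightarrow> q = u" by blast
  show ?thesis
  proof (rule that)
    show "sublinear_wrt s u" "u x \<le> p x" for x using u(1) by (auto simp: A_def)
    show "q = u" if "sublinear_wrt s q" "\<And>x. q x \<le> u x" for q
    proof (rule u(2))
      show "q \<in> A" using u(1) that order_trans by (fastforce simp: A_def)
      show "P u q" using that by (simp add: P_def)
    qed
  qed
qed

text \<open>The minimal function \<open>u\<close> equals all its tilts, so that \<open>u x \<le> u (x + b) - u b\<close>: the missing half of
additivity. Starting from the tilt of \<open>p\<close> at \<open>a\<close> instead of \<open>p\<close> itself gives \<open>u (- a) \<le> - p a\<close>, which
forces \<open>u a = p a\<close>.\<close>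
theorem ex_linear_dominated:
  assumes p: "sublinear_wrt s p"
  obtains u where "\<And>x y. u (x + y) = u x + u y" "\<And>r x. u (s r x) = r * u x"
    "\<And>x. u x \<le> p x" "u a = p a"
proof -
  have "sublinear_wrt s (tilt s p a)" using p by (rule sublinear_tilt)
  then obtain u where u: "sublinear_wrt s u" and le: "\<And>x. u x \<le> tilt s p a x"
    and min: "\<And>q. sublinear_wrt s q \<Longrightarrow> (\<And>x. q x \<le> u x) \<Longrightarrow> q = u"
    by (rule ex_minimal_sublinear) auto
  have tilt_u: "tilt s u b = u" for b
    using sublinear_tilt[OF u] tilt_le_self[OF u] by (rule min)
  have add: "u (x + y) = u x + u y" for x y
  proof (rule antisym)
    show "u (x + y) \<le> u x + u y" by (rule sublinear_add[OF u])
    show "u x + u y \<le> u (x + y)"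
      using tilt_le[OF u, of 1 y x] by (simp add: tilt_u)
  qed
  have neg: "u (- x) = - u x" for x
    using add[of x "- x"] sublinear_0[OF u] by simp
  have lep: "u x \<le> p x" for x
    using le tilt_le_self[OF p] order_trans by blast
  show ?thesis
  proof (rule that)
    show "u (s r x) = r * u x" for r x
    proof (cases "0 \<le> r")
      case True
      then show ?thesis by (rule sublinear_scale[OF u])
    next
      case False
      then have "u (s (- r) x) = - r * u x" by (intro sublinear_scale[OF u]) simp
      then show ?thesis by (simp add: neg)
    qed
    have "u (- a) \<le> p (- a + s 1 a) - 1 * p a"
      using le[of "- a"] tilt_le[OF p, of 1 a "- a"] by linarith
    then have "p a \<le> u a" by (simp add: neg sublinear_0[OF p])
    then show "u a = p a" using lep[of a] by simp
  qed (fact add lep)+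
qed

end

section \<open>The scalar field\<close>

text \<open>That the embedding fixes the real numbers is a consequence of its being isometric: a complex number \<open>z\<close>
with \<open>\<bar>z\<bar> = \<bar>r\<bar>\<close> and \<open>\<bar>z + 1\<bar> = \<bar>r + 1\<bar>\<close> is \<open>r\<close>.\<close>
lemma complex_embedding:
  obtains e :: "'k::real_or_complex \<Rightarrow> complex"
  where "\<And>x y. e (x + y) = e x + e y" "\<And>x y. e (x * y) = e x * e y"
    "\<And>r. e (of_real r) = of_real r" "\<And>x. norm (e x) = norm x"
    "range e = \<real> \<or> range e = UNIV" "\<And>x. re_part x = Re (e x)"
proof -
  obtain e :: "'k \<Rightarrow> complex"
    where e: "\<And>x y. e (x + y) = e x + e y" "\<And>x y. e (x * y) = e x * e y" "e 1 = 1"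
      "\<And>x. norm (e x) = norm x" "range e = \<real> \<or> range e = UNIV" "\<And>x. re_part x = Re (e x)"
    using ex_complex_embedding by metis
  have "e (of_real r) = of_real r" for r
  proof (rule complex_eqI)
    let ?z = "e (of_real r)"
    have "norm (?z + 1) = norm (of_real r + 1 :: 'k)" by (simp only: e(1,3) flip: e(4))
    also have "\<dots> = \<bar>r + 1\<bar>" by (metis norm_of_real of_real_1 of_real_add)
    finally have n1: "norm (?z + 1) = \<bar>r + 1\<bar>" .
    have n0: "norm ?z = \<bar>r\<bar>" by (simp add: e(4))
    have z1: "(Re ?z + 1)\<^sup>2 + (Im ?z)\<^sup>2 = (r + 1)\<^sup>2"
      using arg_cong[OF n1, of "\<lambda>t. t\<^sup>2"] by (simp add: cmod_power2)
    have z0: "(Re ?z)\<^sup>2 + (Im ?z)\<^sup>2 = r\<^sup>2"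
      using arg_cong[OF n0, of "\<lambda>t. t\<^sup>2"] by (simp add: cmod_power2)
    have "Re ?z = r" using z0 z1 by (simp add: power2_eq_square algebra_simps)
    moreover from this have "Im ?z = 0" using z0 by simp
    ultimately show "Re ?z = Re (of_real r)" "Im ?z = Im (of_real r)" by simp_all
  qed
  then show ?thesis using e(1,2,4-6) by (intro that[of e])
qed

lemma re_part_of_real_mult: "re_part (of_real r * x :: 'k::real_or_complex) = r * re_part x"
proof -
  obtain e :: "'k \<Rightarrow> complex" where "\<And>x y. e (x * y) = e x * e y"
    "\<And>r. e (of_real r) = of_real r" "\<And>x. re_part x = Re (e x)"
    by (rule complex_embedding) blast
  then show ?thesis by simp
qed

lemma re_part_of_real: "re_part (of_real r :: 'k::real_or_complex) = r"
proof -
  obtain e :: "'k \<Rightarrow> complex" where "\<And>r. e (of_real r) = of_real r" "\<And>x. re_part x = Re (e x)"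
    by (rule complex_embedding) blast
  then show ?thesis by simp
qed

lemma re_part_0: "re_part (0 :: 'k::real_or_complex) = 0"
  using re_part_of_real[of 0, where 'k = 'k] by simp

lemma re_part_le_norm: "re_part (x :: 'k::real_or_complex) \<le> norm x"
proof -
  obtain e :: "'k \<Rightarrow> complex" where "\<And>x. norm (e x) = norm x" "\<And>x. re_part x = Re (e x)"
    by (rule complex_embedding) blast
  then show ?thesis using complex_Re_le_cmod[of "e x"] by simp
qed

text \<open>The embedding is injective, so real and imaginary parts can be carried back to the scalar type, where
\<open>i\<close> is the preimage of the imaginary unit.\<close>
lemma scalar_field_cases:
  obtains (real) "\<And>x :: 'k::real_or_complex. x = of_real (re_part x)"
  | (complex) i :: "'k::real_or_complex" where "i * i = - 1"
      "\<And>x. \<exists>b. x = of_real (re_part x) + i * of_real b"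
      "\<And>a b. re_part (of_real a + i * of_real b) = a"
proof -
  obtain e :: "'k \<Rightarrow> complex"
    where e: "\<And>x y. e (x + y) = e x + e y" "\<And>x y. e (x * y) = e x * e y"
      "\<And>r. e (of_real r) = of_real r" "\<And>x. norm (e x) = norm x"
      "range e = \<real> \<or> range e = UNIV" "\<And>x. re_part x = Re (e x)"
    by (rule complex_embedding) blast
  have e_minus: "e (- x) = - e x" for x
    using e(2)[of "of_real (- 1)" x] by (simp only: e(3)) simp
  have inj: "x = y" if "e x = e y" for x y
  proof -
    have "e (x - y) = 0" using e(1)[of x "- y"] that by (simp add: e_minus)
    then show ?thesis using e(4)[of "x - y"] by simp
  qed
  from e(5) show ?thesis
  proof
    assume R: "range e = \<real>"
    have "x = of_real (re_part x)" for x :: 'k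
    proof (rule inj)
      have "e x \<in> \<real>" using R by blast
      then show "e x = e (of_real (re_part x))"
        by (simp add: e(3,6) complex_is_Real_iff complex_eq_iff)
    qed
    then show ?thesis by (rule real)
  next
    assume "range e = UNIV"
    then obtain i where i: "e i = \<i>" by (metis rangeE UNIV_I)
    show ?thesis
    proof (rule complex)
      have "e (- 1) = - 1" using e_minus[of 1] e(3)[of 1] by simp
      then show "i * i = - 1" by (intro inj) (simp add: e(2) i)
      show "\<exists>b. x = of_real (re_part x) + i * of_real b" for x :: 'k
        by (rule exI[of _ "Im (e x)"], rule inj) (simp add: e(1-3,6) i complex_eq[symmetric])
      show "re_part (of_real a + i * of_real b) = a" for a b by (simp add: e(1-3,6) i)
    qed
  qed
qed

text \<open>In the complex case \<open>f x = u x - i u (i x)\<close>. This map is real-linear and commutes with \<open>i\<close>, hence with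
every scalar.\<close>
lemma ex_linear_with_real_part:
  fixes scal :: "'k::real_or_complex \<Rightarrow> 'a::ab_group_add \<Rightarrow> 'a"
  assumes "vector_space scal"
    and add: "\<And>x y. u (x + y) = u x + u y"
    and sc: "\<And>r x. u (scal (of_real r) x) = r * u x"
  obtains f where "Vector_Spaces.linear scal (*) f" "\<And>x. re_part (f x) = u x"
proof -
  interpret vector_space scal by fact
  have vs: "vector_space ((*) :: 'k \<Rightarrow> 'k \<Rightarrow> 'k)" by unfold_locales (auto simp: algebra_simps)
  show ?thesis
  proof (cases rule: scalar_field_cases[where 'k='k])
    case real
    show ?thesis
    proof (rule that[of "\<lambda>x. of_real (u x)"])
      have "of_real (u (scal c x)) = c * of_real (u x)" for c x
        using sc[of "re_part c" x] real[of c] by simp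
      then show "Vector_Spaces.linear scal (*) (\<lambda>x. of_real (u x) :: 'k)"
        using vs assms(1) by (simp add: Vector_Spaces.linear_iff add)
    qed (simp add: re_part_of_real)
  next
    case (complex i)
    define f :: "'a \<Rightarrow> 'k" where "f x = of_real (u x) + i * of_real (- u (scal i x))" for x
    have fadd: "f (x + y) = f x + f y" for x y
      by (simp add: f_def add scale_right_distrib algebra_simps)
    have fr: "f (scal (of_real r) x) = of_real r * f x" for r x
    proof -
      have "u (scal i (scal (of_real r) x)) = r * u (scal i x)"
        by (simp only: scale_left_commute[of i "of_real r" x] sc)
      then show ?thesis by (simp add: f_def sc algebra_simps)
    qed
    have fi: "f (scal i x) = i * f x" for x
    proof -
      have "scal i (scal i x) = scal (of_real (- 1)) x" by (simp add: complex(1))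
      then have "u (scal i (scal i x)) = - u x" by (simp only: sc mult_minus1)
      then have "f (scal i x) = of_real (u (scal i x)) + i * of_real (u x)" by (simp add: f_def)
      moreover have "i * (i * z) = - z" for z using complex(1) by (metis mult.assoc mult_minus1)
      then have "i * f x = of_real (u (scal i x)) + i * of_real (u x)"
        by (simp add: f_def right_diff_distrib)
      ultimately show ?thesis by simp
    qed
    have "f (scal c x) = c * f x" for c x
    proof -
      obtain b where c: "c = of_real (re_part c) + i * of_real b" using complex(2) by blast
      have "f (scal c x) = f (scal (of_real (re_part c)) x + scal i (scal (of_real b) x))"
        by (subst c) (simp add: scale_left_distrib)
      also have "\<dots> = (of_real (re_part c) + i * of_real b) * f x"
        by (simp only: fadd fr fi) (simp add: algebra_simps)
      finally show ?thesis using c by simp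
    qed
    then have "Vector_Spaces.linear scal (*) f"
      using vs assms(1) by (simp add: Vector_Spaces.linear_iff fadd)
    moreover have "re_part (f x) = u x" for x unfolding f_def by (rule complex(3))
    ultimately show ?thesis by (rule that)
  qed
qed

section \<open>Seminorms and the Hahn-Banach theorem\<close>

definition seminorm_wrt ::
    "('k::real_normed_field \<Rightarrow> 'a::ab_group_add \<Rightarrow> 'a) \<Rightarrow> ('a \<Rightarrow> real) \<Rightarrow> bool" where
  "seminorm_wrt scal p \<longleftrightarrow>
     (\<forall>x y. p (x + y) \<le> p x + p y) \<and> (\<forall>c x. p (scal c x) = norm c * p x)"

locale normed_scaling = vector_space scal
  for scal :: "'k::real_normed_field \<Rightarrow> 'a::ab_group_add \<Rightarrow> 'a"
begin

lemma
  assumes "seminorm_wrt scal p"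
  shows seminorm_add: "p (x + y) \<le> p x + p y"
    and seminorm_scale: "p (scal c x) = norm c * p x"
    and seminorm_0: "p 0 = 0"
    and seminorm_minus: "p (- x) = p x"
    and seminorm_nonneg: "0 \<le> p x"
    and seminorm_diff: "\<bar>p x - p y\<bar> \<le> p (x - y)"
proof -
  show add: "p (x + y) \<le> p x + p y" for x y using assms by (simp add: seminorm_wrt_def)
  show sc: "p (scal c x) = norm c * p x" for c x using assms by (simp add: seminorm_wrt_def)
  show p0: "p 0 = 0" using sc[of 0 0] by simp
  show m: "p (- x) = p x" for x using sc[of "- 1" x] by simp
  show "0 \<le> p x" using add[of x "- x"] by (simp add: p0 m)
  show "\<bar>p x - p y\<bar> \<le> p (x - y)"
    using add[of "x - y" y] add[of "y - x" x] m[of "x - y"] by simp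
qed

lemma absolutely_convex_seminorm_le:
  assumes p: "seminorm_wrt scal p"
  shows "absolutely_convex scal {x. p x \<le> r}"
proof -
  have "p (scal (of_real u) x + scal (of_real v) y) \<le> r"
    if "p x \<le> r" "p y \<le> r" "0 \<le> u" "0 \<le> v" "u + v = 1" for x y u v
  proof -
    have "p (scal (of_real u) x + scal (of_real v) y) \<le> u * p x + v * p y"
      using seminorm_add[OF p] that by (metis abs_of_nonneg norm_of_real seminorm_scale[OF p])
    also have "\<dots> \<le> r" using that by (intro convex_bound_le)
    finally show ?thesis .
  qed
  moreover have "p (scal c x) \<le> r" if "p x \<le> r" "norm c \<le> 1" for c x
    using that mult_left_le_one_le[OF seminorm_nonneg[OF p, of x] norm_ge_zero[of c]]
    by (simp add: seminorm_scale[OF p])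
  ultimately show ?thesis
    by (simp add: absolutely_convex_def convex_wrt_def)
qed

end

text \<open>The bound on the real part of \<open>f\<close> extends to its norm by rotating \<open>f x\<close> onto the positive real axis with a
scalar of norm \<open>1\<close>, which does not change \<open>p x\<close>.\<close>
theorem Hahn_Banach_seminorm:
  fixes scal :: "'k::real_or_complex \<Rightarrow> 'a::ab_group_add \<Rightarrow> 'a"
  assumes "vector_space scal" and p: "seminorm_wrt scal p"
  obtains f where "Vector_Spaces.linear scal (*) f" "\<And>x. norm (f x) \<le> p x" "re_part (f a) = p a"
proof -
  interpret normed_scaling scal using assms(1) by (simp add: normed_scaling_def)
  interpret R: real_scaling "\<lambda>r. scal (of_real r)"
    by unfold_locales (auto simp: scale_right_distrib scale_left_distrib)
  have "sublinear_wrt (\<lambda>r. scal (of_real r)) p"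
    by (rule R.sublinear_wrtI) (auto simp: seminorm_add[OF p] seminorm_scale[OF p])
  then obtain u where u: "\<And>x y. u (x + y) = u x + u y" "\<And>r x. u (scal (of_real r) x) = r * u x"
    "\<And>x. u x \<le> p x" "u a = p a"
    by (rule R.ex_linear_dominated[where a = a]) auto
  obtain f where f: "Vector_Spaces.linear scal (*) f" "\<And>x. re_part (f x) = u x"
    using assms(1) u(1,2) by (rule ex_linear_with_real_part) auto
  show ?thesis
  proof (rule that)
    show "norm (f x) \<le> p x" for x
    proof (cases "f x = 0")
      case True
      then show ?thesis by (simp add: seminorm_nonneg[OF p])
    next
      case False
      define c where "c = of_real (norm (f x)) / f x"
      have "f (scal c x) = c * f x" using f(1) by (simp add: Vector_Spaces.linear_iff)
      then have "f (scal c x) = of_real (norm (f x))" using False by (simp add: c_def)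
      then have "norm (f x) = u (scal c x)" by (metis f(2) re_part_of_real)
      also have "\<dots> \<le> p (scal c x)" by (rule u(3))
      also have "\<dots> = p x" using False by (simp add: seminorm_scale[OF p] c_def norm_divide)
      finally show ?thesis .
    qed
  qed (use f u in auto)
qed

section \<open>Topological vector spaces\<close>

lemma null_neighborhood_mono: "null_neighborhood \<tau> U \<Longrightarrow> U \<subseteq> V \<Longrightarrow> null_neighborhood \<tau> V"
  unfolding null_neighborhood_def by blast

lemma null_neighborhood_INT:
  assumes "finite I" "topspace \<tau> = UNIV" "\<And>i. i \<in> I \<Longrightarrow> null_neighborhood \<tau> (U i)"
  shows "null_neighborhood \<tau> (\<Inter>i\<in>I. U i)"
  using assms(1,3)
proof (induction I)
  case empty
  then show ?case using openin_topspace[of \<tau>] assms(2) by (auto simp: null_neighborhood_def)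
next
  case (insert j I)
  obtain W where "openin \<tau> W" "0 \<in> W" "W \<subseteq> U j"
    using insert.prems[of j] by (auto simp: null_neighborhood_def)
  moreover obtain W' where "openin \<tau> W'" "0 \<in> W'" "W' \<subseteq> (\<Inter>i\<in>I. U i)"
    using insert.IH insert.prems unfolding null_neighborhood_def by blast
  ultimately show ?case unfolding null_neighborhood_def
    by (intro exI[of _ "W \<inter> W'"]) auto
qed

locale topological_scaling = normed_scaling scal
  for scal :: "'k::real_normed_field \<Rightarrow> 'a::ab_group_add \<Rightarrow> 'a" +
  fixes \<tau> :: "'a topology"
  assumes vst: "vector_space_topology scal \<tau>"
begin

lemma topspace_UNIV [simp]: "topspace \<tau> = UNIV"
  using vst by (simp add: vector_space_topology_def)

lemma continuous_map_translate: "continuous_map \<tau> \<tau> (\<lambda>y. a + y)"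
proof -
  have "continuous_map \<tau> (prod_topology \<tau> \<tau>) (\<lambda>y. (a, y))"
    by (intro continuous_map_pairedI) auto
  then have "continuous_map \<tau> \<tau> ((\<lambda>(x, y). x + y) \<circ> (\<lambda>y. (a, y)))"
    using vst unfolding vector_space_topology_def by (blast intro: continuous_map_compose)
  then show ?thesis by (simp add: o_def)
qed

lemma continuous_map_scale_vector: "continuous_map \<tau> \<tau> (scal c)"
proof -
  have "continuous_map \<tau> (prod_topology euclidean \<tau>) (\<lambda>y. (c, y))"
    by (intro continuous_map_pairedI) auto
  then have "continuous_map \<tau> \<tau> ((\<lambda>(c, x). scal c x) \<circ> (\<lambda>y. (c, y)))"
    using vst unfolding vector_space_topology_def by (blast intro: continuous_map_compose)
  then show ?thesis by (simp add: o_def)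
qed

lemma continuous_map_scale_scalar: "continuous_map euclidean \<tau> (\<lambda>c. scal c x)"
proof -
  have "continuous_map euclidean (prod_topology euclidean \<tau>) (\<lambda>c :: 'k. (c, x))"
    by (intro continuous_map_pairedI) auto
  then have "continuous_map euclidean \<tau> ((\<lambda>(c, x). scal c x) \<circ> (\<lambda>c. (c, x)))"
    using vst unfolding vector_space_topology_def by (blast intro: continuous_map_compose)
  then show ?thesis by (simp add: o_def)
qed

lemma openin_preimage:
  "continuous_map \<tau> \<tau> f \<Longrightarrow> openin \<tau> W \<Longrightarrow> openin \<tau> {x. f x \<in> W}"
  using openin_continuous_map_preimage[of \<tau> \<tau> f W] by simp

text \<open>Translations are homeomorphisms, so openness can be tested with null neighborhoods.\<close>
lemma openinI_null_neighborhood: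
  assumes "\<And>x. x \<in> S \<Longrightarrow> null_neighborhood \<tau> {y. x + y \<in> S}"
  shows "openin \<tau> S"
proof (subst openin_subopen, intro ballI)
  fix x assume "x \<in> S"
  then obtain W where W: "openin \<tau> W" "0 \<in> W" "W \<subseteq> {y. x + y \<in> S}"
    using assms unfolding null_neighborhood_def by blast
  have "z \<in> S" if "- x + z \<in> W" for z
    using subsetD[OF W(3) that] by simp
  then show "\<exists>T. openin \<tau> T \<and> x \<in> T \<and> T \<subseteq> S"
    using openin_preimage[OF continuous_map_translate W(1), of "- x"] W(2)
    by (intro exI[of _ "{z. - x + z \<in> W}"]) auto
qed

lemma null_neighborhood_scale:
  assumes "null_neighborhood \<tau> U"
  shows "null_neighborhood \<tau> {x. scal c x \<in> U}"
proof -
  obtain W where W: "openin \<tau> W" "0 \<in> W" "W \<subseteq> U"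
    using assms unfolding null_neighborhood_def by blast
  then show ?thesis unfolding null_neighborhood_def
    using openin_preimage[OF continuous_map_scale_vector W(1), of c]
    by (intro exI[of _ "{x. scal c x \<in> W}"]) auto
qed

lemma null_neighborhood_absorbing:
  assumes "null_neighborhood \<tau> U"
  shows "\<exists>r>0. scal (of_real (inverse r)) x \<in> U"
proof -
  obtain W where W: "openin \<tau> W" "0 \<in> W" "W \<subseteq> U"
    using assms unfolding null_neighborhood_def by blast
  have "open {c. scal c x \<in> W}"
    using openin_continuous_map_preimage[OF continuous_map_scale_scalar W(1), of x] by simp
  moreover have "0 \<in> {c. scal c x \<in> W}" using W(2) by simp
  ultimately obtain e where e: "0 < e" "ball 0 e \<subseteq> {c. scal c x \<in> W}"
    by (meson open_contains_ball)
  have "of_real (e/2) \<in> ball (0::'k) e" using e(1) by simp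
  then have "scal (of_real (e/2)) x \<in> U" using e(2) W(3) by blast
  then show ?thesis using e(1) by (intro exI[of _ "inverse (e/2)"]) simp
qed

lemma null_neighborhood_seminorm_less:
  assumes p: "seminorm_wrt scal p" and 1: "null_neighborhood \<tau> {x. p x \<le> 1}" and e: "0 < e"
  shows "null_neighborhood \<tau> {x. p x < e}"
proof (rule null_neighborhood_mono[OF null_neighborhood_scale[OF 1, of "of_real (2/e)"]])
  have "p x < e" if "2/e * p x \<le> 1" for x
  proof -
    have "2 * p x \<le> e" using that e by (simp add: field_simps)
    then show ?thesis using e by simp
  qed
  then show "{x. scal (of_real (2/e)) x \<in> {x. p x \<le> 1}} \<subseteq> {x. p x < e}"
    using e by (auto simp: seminorm_scale[OF p] simp del: of_real_divide)
qed

text \<open>Used both for the seminorm itself and for the functionals that it dominates.\<close>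
lemma continuous_map_seminorm_dominated:
  fixes g :: "'a \<Rightarrow> 'm::metric_space"
  assumes p: "seminorm_wrt scal p" and 1: "null_neighborhood \<tau> {x. p x \<le> 1}"
    and g: "\<And>x y. dist (g x) (g y) \<le> p (x - y)"
  shows "continuous_map \<tau> euclidean g"
  unfolding continuous_map_def
proof (intro conjI allI impI)
  fix V :: "'m set" assume "openin euclidean V"
  then have V: "open V" by simp
  have "openin \<tau> {x. g x \<in> V}"
  proof (rule openinI_null_neighborhood)
    fix x assume "x \<in> {x. g x \<in> V}"
    then obtain e where e: "0 < e" "ball (g x) e \<subseteq> V" using V open_contains_ball by blast
    have "{y. p y < e} \<subseteq> {y. x + y \<in> {x. g x \<in> V}}"
    proof (intro subsetI CollectI)
      fix y assume "y \<in> {y. p y < e}"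
      moreover have "dist (g x) (g (x + y)) \<le> p y"
        using g[of x "x + y"] seminorm_minus[OF p] by simp
      ultimately have "g (x + y) \<in> ball (g x) e" by simp
      then show "g (x + y) \<in> V" using e by blast
    qed
    then show "null_neighborhood \<tau> {y. x + y \<in> {x. g x \<in> V}}"
      by (rule null_neighborhood_mono[OF null_neighborhood_seminorm_less[OF p 1 e(1)]])
  qed
  then show "openin \<tau> {x \<in> topspace \<tau>. g x \<in> V}" by simp
qed simp

lemma closedin_seminorm_le:
  assumes p: "seminorm_wrt scal p" and 1: "null_neighborhood \<tau> {x. p x \<le> 1}"
  shows "closedin \<tau> {x. p x \<le> r}"
proof -
  have "continuous_map \<tau> euclidean p"
    by (rule continuous_map_seminorm_dominated[OF p 1])
      (simp add: dist_real_def seminorm_diff[OF p])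
  then have "closedin \<tau> {x \<in> topspace \<tau>. p x \<in> {..r}}"
    by (rule closedin_continuous_map_preimage) simp
  then show ?thesis by simp
qed

text \<open>Joint continuity of scalar multiplication at \<open>(0, 0)\<close> gives \<open>e > 0\<close> and a null neighborhood \<open>B\<close> such that
\<open>d y \<in> U\<close> whenever \<open>\<bar>d\<bar> < e\<close> and \<open>y \<in> B\<close>; the core contains \<open>(e/2) B\<close>.\<close>
lemma null_neighborhood_balanced_core:
  assumes "null_neighborhood \<tau> U"
  shows "null_neighborhood \<tau> {x. \<forall>c. norm c \<le> 1 \<longrightarrow> scal c x \<in> U}"
proof -
  obtain W where W: "openin \<tau> W" "0 \<in> W" "W \<subseteq> U"
    using assms unfolding null_neighborhood_def by blast
  have "continuous_map (prod_topology euclidean \<tau>) \<tau> (\<lambda>(c, x). scal c x)"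
    using vst by (simp add: vector_space_topology_def)
  from openin_continuous_map_preimage[OF this W(1)]
  have "openin (prod_topology euclidean \<tau>) {z. (case z of (c, x) \<Rightarrow> scal c x) \<in> W}" by simp
  from this[unfolded openin_prod_topology_alt, rule_format, of 0 0] W(2)
  obtain A B where "openin euclidean A" and B: "openin \<tau> B" and A0: "0 \<in> A" and B0: "0 \<in> B"
      and AB: "A \<times> B \<subseteq> {z. (case z of (c, x) \<Rightarrow> scal c x) \<in> W}"
    by (simp only: mem_Collect_eq case_prod_conv scale_zero_left) blast
  then have A: "open A" by simp
  obtain e where e: "0 < e" "ball 0 e \<subseteq> A" using A A0 by (meson open_contains_ball)
  have "null_neighborhood \<tau> B" using B B0 by (auto simp: null_neighborhood_def)
  then have "null_neighborhood \<tau> {x. scal (of_real (2/e)) x \<in> B}"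
    by (rule null_neighborhood_scale)
  moreover have "scal c x \<in> U" if x: "scal (of_real (2/e)) x \<in> B" and c: "norm c \<le> 1" for x c
  proof -
    have "norm (c * of_real (e/2)) = norm c * (e/2)" using e(1) by (simp add: norm_mult)
    also have "\<dots> < e" using mult_right_mono[OF c, of "e/2"] e(1) by linarith
    finally have "c * of_real (e/2) \<in> A" using e(2) by auto
    then have "(c * of_real (e/2), scal (of_real (2/e)) x) \<in> A \<times> B" using x by (rule SigmaI)
    from subsetD[OF AB this]
    have "scal (c * of_real (e/2)) (scal (of_real (2/e)) x) \<in> W" by (simp only: mem_Collect_eq case_prod_conv)
    moreover have "of_real (e/2) * of_real (2/e) = (1 :: 'k)"
      using e(1) by (simp flip: of_real_mult)
    then have "scal (c * of_real (e/2)) (scal (of_real (2/e)) x) = scal c x"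
      by (simp only: scale_scale mult.assoc mult_1_right)
    ultimately show ?thesis using W(3) by auto
  qed
  ultimately show ?thesis by (elim null_neighborhood_mono) auto
qed

end

text \<open>The balanced core is an intersection of preimages of \<open>U\<close> under linear maps and so inherits convexity.\<close>
lemma (in normed_scaling) absolutely_convex_balanced_core:
  assumes "convex_wrt scal U"
  shows "absolutely_convex scal {x. \<forall>c. norm c \<le> 1 \<longrightarrow> scal c x \<in> U}"
proof -
  have "scal c (scal (of_real u) x + scal (of_real v) y) \<in> U"
    if "\<And>c. norm c \<le> 1 \<Longrightarrow> scal c x \<in> U" "\<And>c. norm c \<le> 1 \<Longrightarrow> scal c y \<in> U"
      "0 \<le> u" "0 \<le> v" "u + v = 1" "norm c \<le> 1" for x y u v c
  proof -
    have "scal (of_real u) (scal c x) + scal (of_real v) (scal c y) \<in> U"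
      using assms that unfolding convex_wrt_def by blast
    then show ?thesis by (simp add: scale_right_distrib mult.commute)
  qed
  moreover have "norm (c * d) \<le> 1" if "norm c \<le> 1" "norm d \<le> 1" for c d :: 'k
    using that by (simp add: norm_mult mult_le_one)
  ultimately show ?thesis
    by (simp add: absolutely_convex_def convex_wrt_def)
qed

lemma ex_absolutely_convex_null_neighborhood:
  assumes "vector_space scal" "locally_convex_topology scal \<tau>" "null_neighborhood \<tau> U"
  obtains D where "absolutely_convex scal D" "null_neighborhood \<tau> D" "D \<subseteq> U"
proof -
  interpret topological_scaling scal \<tau>
    using assms(1,2) by (simp add: topological_scaling_def topological_scaling_axioms_def
        normed_scaling_def locally_convex_topology_def)
  obtain V where V: "null_neighborhood \<tau> V" "convex_wrt scal V" "V \<subseteq> U"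
    using assms(2,3) unfolding locally_convex_topology_def by blast
  show ?thesis
  proof
    show "absolutely_convex scal {x. \<forall>c. norm c \<le> 1 \<longrightarrow> scal c x \<in> V}"
      by (rule absolutely_convex_balanced_core[OF V(2)])
    show "null_neighborhood \<tau> {x. \<forall>c. norm c \<le> 1 \<longrightarrow> scal c x \<in> V}"
      by (rule null_neighborhood_balanced_core[OF V(1)])
    have "x \<in> V" if "\<forall>c. norm c \<le> 1 \<longrightarrow> scal c x \<in> V" for x
      using that[rule_format, of 1] by simp
    then show "{x. \<forall>c. norm c \<le> 1 \<longrightarrow> scal c x \<in> V} \<subseteq> U" using V(3) by blast
  qed
qed

section \<open>Minkowski functionals\<close>

definition minkowski ::
    "('k::real_normed_field \<Rightarrow> 'a::ab_group_add \<Rightarrow> 'a) \<Rightarrow> 'a set \<Rightarrow> 'a \<Rightarrow> real" where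
  "minkowski scal D x = Inf {r. 0 < r \<and> scal (of_real (inverse r)) x \<in> D}"

context normed_scaling
begin

lemma minkowski_le:
  "0 < r \<Longrightarrow> scal (of_real (inverse r)) x \<in> D \<Longrightarrow> minkowski scal D x \<le> r"
  unfolding minkowski_def by (rule cInf_lower) (auto intro!: bdd_belowI[of _ 0])

lemma minkowski_le_1: "x \<in> D \<Longrightarrow> minkowski scal D x \<le> 1"
  using minkowski_le[of 1 x D] by simp

context
  fixes D :: "'a set"
  assumes D: "absolutely_convex scal D"
    and absorbing: "\<And>x. \<exists>r>0. scal (of_real (inverse r)) x \<in> D"
begin

lemma minkowski_nonneg: "0 \<le> minkowski scal D x"
  unfolding minkowski_def using absorbing[of x] by (intro cInf_greatest) auto

text \<open>The infimum need not be attained, so membership in a multiple of \<open>D\<close> is only available under a strict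
inequality.\<close>
lemma minkowski_less_imp_scale_mem:
  assumes "minkowski scal D x < r" "norm c \<le> inverse r"
  shows "scal c x \<in> D"
proof -
  obtain t where t: "0 < t" "t < r" "scal (of_real (inverse t)) x \<in> D"
    using assms(1) absorbing[of x] cInf_lessD[of "{r. 0 < r \<and> scal (of_real (inverse r)) x \<in> D}" r]
    unfolding minkowski_def by blast
  have "norm (c * of_real t) \<le> inverse r * t"
    using assms(2) t(1) by (simp add: norm_mult mult_right_mono)
  also have "\<dots> \<le> 1" using t by (simp add: field_simps)
  finally have "scal (c * of_real t) (scal (of_real (inverse t)) x) \<in> D"
    using D t(3) unfolding absolutely_convex_def by blast
  then show ?thesis using t(1) by (simp add: mult.assoc flip: of_real_mult)
qed

lemma minkowski_less_1_imp_mem: "minkowski scal D x < 1 \<Longrightarrow> x \<in> D"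
  using minkowski_less_imp_scale_mem[of x 1 1] by simp

text \<open>If \<open>x \<in> r D\<close> and \<open>y \<in> s D\<close>, then \<open>(x + y)/(r + s)\<close> is a convex combination of \<open>x/r\<close> and \<open>y/s\<close>, whence
\<open>x + y \<in> (r + s) D\<close>; balancedness gives homogeneity.\<close>
lemma seminorm_minkowski: "seminorm_wrt scal (minkowski scal D)"
proof -
  let ?p = "minkowski scal D"
  have add: "?p (x + y) \<le> ?p x + ?p y" for x y
  proof (rule field_le_epsilon)
    fix e :: real assume e: "0 < e"
    \<comment> \<open>The slack \<open>e/2\<close> puts \<open>x\<close> into \<open>r D\<close> and \<open>y\<close> into \<open>s D\<close>.\<close>
    define r s where rs: "r = ?p x + e/2" "s = ?p y + e/2"
    have pos: "0 < r" "0 < s"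
      using e minkowski_nonneg by (auto simp: rs intro: add_nonneg_pos)
    have "?p x < r" "?p y < s" using e by (simp_all add: rs)
    then have "scal (of_real (inverse r)) x \<in> D" "scal (of_real (inverse s)) y \<in> D"
      using pos by (auto elim!: minkowski_less_imp_scale_mem simp: norm_inverse)
    moreover have "r/(r+s) + s/(r+s) = 1" using pos by (simp flip: add_divide_distrib)
    moreover have "0 \<le> r/(r+s)" "0 \<le> s/(r+s)" using pos by auto
    ultimately have "scal (of_real (r/(r+s))) (scal (of_real (inverse r)) x) +
        scal (of_real (s/(r+s))) (scal (of_real (inverse s)) y) \<in> D"
      using D unfolding absolutely_convex_def convex_wrt_def by blast
    moreover have "r/(r+s) * inverse r = inverse (r+s)" "s/(r+s) * inverse s = inverse (r+s)"
      using pos by (auto simp: field_simps)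
    ultimately have "scal (of_real (inverse (r+s))) (x + y) \<in> D"
      by (simp only: scale_scale scale_right_distrib flip: of_real_mult)
    then have "?p (x + y) \<le> r + s" using pos by (intro minkowski_le) auto
    then show "?p (x + y) \<le> ?p x + ?p y + e" by (simp add: rs)
  qed
  have le: "?p (scal c x) \<le> norm c * ?p x" if c: "c \<noteq> 0" for c x
  proof (rule field_le_epsilon)
    fix e :: real assume e: "0 < e"
    define r where r: "r = norm c * ?p x + e"
    have pos: "0 < r" using e minkowski_nonneg[of x] by (auto simp: r intro: add_nonneg_pos)
    have "scal (of_real (inverse r) * c) x \<in> D"
    proof (rule minkowski_less_imp_scale_mem)
      show "?p x < r / norm c" using c e by (simp add: r field_simps)
      show "norm (of_real (inverse r) * c) \<le> inverse (r / norm c)"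
        using pos by (simp only: norm_mult norm_of_real) (simp add: field_simps)
    qed
    then have "?p (scal c x) \<le> r" using pos by (intro minkowski_le) auto
    then show "?p (scal c x) \<le> norm c * ?p x + e" by (simp add: r)
  qed
  have ge: "norm c * ?p x \<le> ?p (scal c x)" if c: "c \<noteq> 0" for c x
    using le[of "inverse c" "scal c x"] c by (simp add: norm_inverse) (simp add: field_simps)
  have zero: "?p 0 = 0"
  proof -
    have "norm (2::'k) = 2" by simp
    then show ?thesis using le[of 2 0] ge[of 2 0] by simp
  qed
  have "?p (scal c x) = norm c * ?p x" for c x
    using le[of c x] ge[of c x] zero by (cases "c = 0") auto
  then show ?thesis using add by (simp add: seminorm_wrt_def)
qed

end

end

section \<open>Separating sequences of null neighborhoods\<close>

text \<open>The Hahn-Banach functional for \<open>p\<close> at \<open>a\<close> belongs to the polar, and its real part at \<open>a\<close> is \<open>p a\<close>.\<close>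
lemma support_function_polar_positive:
  assumes "vector_space scal" "vector_space_topology scal \<tau>"
    and p: "seminorm_wrt scal p" and 1: "null_neighborhood \<tau> {x. p x \<le> 1}"
    and le: "\<And>x. x \<in> U \<Longrightarrow> p x \<le> 1" and a: "0 < p a"
  shows "0 < support_function (polar scal \<tau> U) a"
proof -
  interpret topological_scaling scal \<tau>
    using assms(1,2) by (simp add: topological_scaling_def topological_scaling_axioms_def
        normed_scaling_def)
  obtain f where f: "Vector_Spaces.linear scal (*) f" "\<And>x. norm (f x) \<le> p x" "re_part (f a) = p a"
    using assms(1) p by (rule Hahn_Banach_seminorm[where a = a]) auto
  interpret f: Vector_Spaces.linear scal "(*)" f by (rule f(1))
  have "continuous_map \<tau> euclidean f"
    using f(2) by (intro continuous_map_seminorm_dominated[OF p 1]) (simp add: dist_norm flip: f.diff)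
  moreover have "re_part (f x) \<le> 1" if "x \<in> U" for x
    using re_part_le_norm[of "f x"] f(2)[of x] le[OF that] by linarith
  ultimately have "f \<in> polar scal \<tau> U"
    using f(1) by (simp add: polar_def continuous_dual_def)
  then have "ereal (re_part (f a)) \<le> support_function (polar scal \<tau> U) a"
    unfolding support_function_def by (rule SUP_upper)
  then show ?thesis using a f(3) by (metis ereal_less(2) less_le_trans)
qed

lemma zero_in_polar:
  fixes scal :: "'k::real_or_complex \<Rightarrow> 'a::ab_group_add \<Rightarrow> 'a"
  assumes "vector_space scal"
  shows "(\<lambda>x. 0) \<in> polar scal \<tau> U"
proof -
  have "vector_space ((*) :: 'k \<Rightarrow> 'k \<Rightarrow> 'k)" by unfold_locales (auto simp: algebra_simps)
  then show ?thesis
    using assms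
    by (simp add: re_part_0 polar_def continuous_dual_def Vector_Spaces.linear_iff)
qed

text \<open>The \<open>D n\<close> need not be closed; the closed unit balls of their Minkowski functionals are, and the zeros of
these Minkowski functionals still lie in \<open>D n\<close>, hence in \<open>B n\<close>.\<close>
lemma countably_separatedI:
  fixes scal :: "'k::real_or_complex \<Rightarrow> 'a::ab_group_add \<Rightarrow> 'a" and B :: "nat \<Rightarrow> 'a set"
  assumes vs: "vector_space scal" and lc: "locally_convex_topology scal \<tau>"
    and B: "\<And>n. null_neighborhood \<tau> (B n)" "(\<Inter>n. B n) = {0}"
  shows "countably_separated scal \<tau>"
proof -
  have vst: "vector_space_topology scal \<tau>" using lc by (simp add: locally_convex_topology_def)
  interpret topological_scaling scal \<tau>
    using vs vst by (simp add: topological_scaling_def topological_scaling_axioms_def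
        normed_scaling_def)
  have "\<exists>D. absolutely_convex scal D \<and> null_neighborhood \<tau> D \<and> D \<subseteq> B n" for n
    using vs lc B(1)[of n] by (rule ex_absolutely_convex_null_neighborhood) auto
  then obtain D where D: "\<And>n. absolutely_convex scal (D n)" "\<And>n. null_neighborhood \<tau> (D n)"
      "\<And>n. D n \<subseteq> B n" by metis
  define p where "p n = minkowski scal (D n)" for n
  have p: "seminorm_wrt scal (p n)" for n
    unfolding p_def using D(1) null_neighborhood_absorbing[OF D(2)] by (rule seminorm_minkowski)
  have p_less: "x \<in> D n" if "p n x < 1" for n x
    using D(1) null_neighborhood_absorbing[OF D(2)] that unfolding p_def
    by (rule minkowski_less_1_imp_mem)
  have p1: "null_neighborhood \<tau> {x. p n x \<le> 1}" for n
    by (rule null_neighborhood_mono[OF D(2)[of n]]) (auto simp: p_def minkowski_le_1)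
  define U where "U n = {x. p n x \<le> 1}" for n
  have "absolutely_convex scal (U n) \<and> closedin \<tau> (U n) \<and> null_neighborhood \<tau> (U n)" for n
    unfolding U_def using absolutely_convex_seminorm_le[OF p] closedin_seminorm_le[OF p p1] p1
    by blast
  moreover have "(\<Inter>n. {x. support_function (polar scal \<tau> (U n)) x = 0}) = {0}"
  proof (intro equalityI subsetI)
    fix x assume "x \<in> (\<Inter>n. {x. support_function (polar scal \<tau> (U n)) x = 0})"
    then have S: "support_function (polar scal \<tau> (U n)) x = 0" for n by simp
    have "p n x = 0" for n
    proof (rule ccontr)
      assume "p n x \<noteq> 0"
      then have "0 < p n x" using seminorm_nonneg[OF p, of n x] by simp
      then have "0 < support_function (polar scal \<tau> (U n)) x"
        by (intro support_function_polar_positive[OF vs vst p p1]) (auto simp: U_def)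
      then show False using S by simp
    qed
    then have "x \<in> (\<Inter>n. B n)" using p_less D(3) by fastforce
    then show "x \<in> {0}" using B(2) by simp
  next
    fix x :: 'a assume "x \<in> {0}"
    have "re_part (f 0) = 0" if "f \<in> polar scal \<tau> (U n)" for f :: "'a \<Rightarrow> 'k" and n
    proof -
      have "f (scal 0 0) = 0 * f 0"
        using that unfolding polar_def continuous_dual_def Vector_Spaces.linear_iff by blast
      then show ?thesis by (simp add: re_part_0)
    qed
    then have "support_function (polar scal \<tau> (U n)) 0 = (SUP f\<in>polar scal \<tau> (U n). 0)" for n
      unfolding support_function_def by (intro SUP_cong) (auto simp: zero_ereal_def)
    moreover have "polar scal \<tau> (U n) \<noteq> {}" for n using zero_in_polar[OF vs] by blast
    ultimately show "x \<in> (\<Inter>n. {x. support_function (polar scal \<tau> (U n)) x = 0})"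
      using \<open>x \<in> {0}\<close> by simp
  qed
  ultimately show ?thesis unfolding countably_separated_def by blast
qed

lemma metrizable_ex_separating_open_sequence:
  assumes "metrizable_space \<rho>" "a \<in> topspace \<rho>"
  obtains B :: "nat \<Rightarrow> 'a set" where "\<And>n. openin \<rho> (B n)" "(\<Inter>n. B n) = {a}"
proof -
  obtain M d where "Metric_space M d" and \<rho>: "\<rho> = Metric_space.mtopology M d"
    using assms(1) by (auto simp: metrizable_space_def)
  then interpret Metric_space M d by simp
  have a: "a \<in> M" using assms(2) by (simp add: \<rho>)
  show ?thesis
  proof
    show "openin \<rho> (mball a (inverse (real (Suc n))))" for n by (simp add: \<rho> openin_mball)
    show "(\<Inter>n. mball a (inverse (real (Suc n)))) = {a}"
    proof (intro equalityI subsetI)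
      fix x assume "x \<in> (\<Inter>n. mball a (inverse (real (Suc n))))"
      then have x: "x \<in> M" "\<And>n. d a x < inverse (real (Suc n))" by auto
      have "d a x = 0"
      proof (rule ccontr)
        assume "d a x \<noteq> 0"
        then have "0 < d a x" using nonneg[of a x] by linarith
        then obtain n where "inverse (real (Suc n)) < d a x" using reals_Archimedean by blast
        then show False using x(2)[of n] by simp
      qed
      then show "x \<in> {a}" using a x by simp
    next
      fix x assume "x \<in> {a}"
      then show "x \<in> (\<Inter>n. mball a (inverse (real (Suc n))))" using a by simp
    qed
  qed
qed

section \<open>The metric of a separating sequence of seminorms\<close>

locale separating_seminorms = normed_scaling scal
  for scal :: "'k::real_normed_field \<Rightarrow> 'a::ab_group_add \<Rightarrow> 'a" +
  fixes p :: "nat \<Rightarrow> 'a \<Rightarrow> real"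
  assumes seminorm: "\<And>n. seminorm_wrt scal (p n)"
    and separating: "\<And>x. (\<And>n. p n x = 0) \<Longrightarrow> x = 0"
begin

text \<open>An F-norm. The factors \<open>(1/2)^n\<close> serve only to make the \<open>n\<close>-th seminorm irrelevant at scales above
\<open>(1/2)^n\<close>, so that a ball constrains finitely many seminorms.\<close>
definition fnorm :: "'a \<Rightarrow> real" where
  "fnorm x = (SUP n. min ((1/2)^n) (p n x))"

lemma fnorm_le_iff: "fnorm x \<le> r \<longleftrightarrow> (\<forall>n. min ((1/2)^n) (p n x) \<le> r)"
proof -
  have "bdd_above (range (\<lambda>n. min ((1/2)^n) (p n x)))"
    by (rule bdd_aboveI2[of _ _ 1]) (simp add: power_le_one min_le_iff_disj)
  then show ?thesis unfolding fnorm_def by (subst cSUP_le_iff) auto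
qed

lemma min_le_fnorm: "min ((1/2)^n) (p n x) \<le> fnorm x"
  using fnorm_le_iff[of x "fnorm x"] by blast

lemma fnorm_nonneg: "0 \<le> fnorm x"
  using min_le_fnorm[of 0 x] seminorm_nonneg[OF seminorm, of 0 x] by (simp add: min_def split: if_splits)

lemma fnorm_0: "fnorm 0 = 0"
  by (intro antisym fnorm_nonneg) (simp add: fnorm_le_iff seminorm_0[OF seminorm])

lemma fnorm_minus: "fnorm (- x) = fnorm x"
  by (simp add: fnorm_def seminorm_minus[OF seminorm])

lemma fnorm_eq_0_imp:
  assumes "fnorm x = 0"
  shows "x = 0"
proof (rule separating)
  fix n
  have "min ((1/2)^n) (p n x) \<le> 0" using min_le_fnorm[of n x] assms by simp
  then have "p n x \<le> 0" using zero_less_power[of "1/2::real" n] by linarith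
  then show "p n x = 0" using seminorm_nonneg[OF seminorm, of n x] by simp
qed

lemma fnorm_add: "fnorm (x + y) \<le> fnorm x + fnorm y"
  unfolding fnorm_le_iff[of "x + y"]
proof
  fix n
  have "min ((1/2)^n) (p n (x + y)) \<le> min ((1/2)^n) (p n x) + min ((1/2)^n) (p n y)"
    using seminorm_add[OF seminorm, of n x y] seminorm_nonneg[OF seminorm, of n x]
      seminorm_nonneg[OF seminorm, of n y] zero_less_power[of "1/2::real" n]
    by linarith
  also have "\<dots> \<le> fnorm x + fnorm y" by (intro add_mono min_le_fnorm)
  finally show "min ((1/2)^n) (p n (x + y)) \<le> fnorm x + fnorm y" .
qed

text \<open>Quasiconvexity, that is, convexity of the balls around \<open>0\<close>. It survives truncation, which destroys
convexity of the function itself, and it survives suprema.\<close>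
lemma fnorm_convex:
  assumes "0 \<le> u" "0 \<le> v" "u + v = 1"
  shows "fnorm (scal (of_real u) x + scal (of_real v) y) \<le> max (fnorm x) (fnorm y)"
  unfolding fnorm_le_iff
proof
  fix n
  let ?m = "max (p n x) (p n y)"
  have "p n (scal (of_real u) x + scal (of_real v) y) \<le> u * p n x + v * p n y"
    using seminorm_add[OF seminorm, of n "scal (of_real u) x" "scal (of_real v) y"] assms
    by (simp add: seminorm_scale[OF seminorm])
  also have "\<dots> \<le> ?m" using assms by (intro convex_bound_le) auto
  finally show "min ((1/2)^n) (p n (scal (of_real u) x + scal (of_real v) y)) \<le> max (fnorm x) (fnorm y)"
    using min_le_fnorm[of n x] min_le_fnorm[of n y] by linarith
qed

lemma fnorm_scale_le:
  assumes "norm c \<le> K" "1 \<le> K"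
  shows "fnorm (scal c x) \<le> K * fnorm x"
  unfolding fnorm_le_iff
proof
  fix n
  have "p n (scal c x) \<le> K * p n x"
    using assms seminorm_nonneg[OF seminorm] by (simp add: seminorm_scale[OF seminorm] mult_right_mono)
  moreover have "(1/2)^n \<le> K * (1/2::real)^n" using mult_right_mono[OF assms(2), of "(1/2)^n"] by simp
  ultimately have "min ((1/2)^n) (p n (scal c x)) \<le> K * min ((1/2)^n) (p n x)"
    using assms(2) by (simp add: min_mult_distrib_left min_le_iff_disj)
  also have "\<dots> \<le> K * fnorm x" using assms(2) min_le_fnorm by (intro mult_left_mono) auto
  finally show "min ((1/2)^n) (p n (scal c x)) \<le> K * fnorm x" .
qed

lemma fnorm_le_if_finitely_many:
  assumes "0 < r"
  obtains k where "\<And>x. (\<And>n. n < k \<Longrightarrow> p n x \<le> r) \<Longrightarrow> fnorm x \<le> r"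
proof -
  obtain k where k: "(1/2::real)^k < r" using assms real_arch_pow_inv[of r "1/2"] by auto
  have "min ((1/2)^n) (p n x) \<le> r" if "\<And>n. n < k \<Longrightarrow> p n x \<le> r" for n x
  proof (cases "n < k")
    case False
    then have "(1/2::real)^n \<le> (1/2)^k" by (intro power_decreasing) auto
    then show ?thesis using k by linarith
  qed (use that in \<open>auto simp: min_le_iff_disj\<close>)
  then show ?thesis using that[of k] unfolding fnorm_le_iff by blast
qed

text \<open>The F-norm is not homogeneous, so continuity in the scalar does not follow from \<open>fnorm_scale_le\<close>; it
comes from the finitely many seminorms that matter at scale \<open>r\<close>.\<close>
lemma fnorm_scale_small:
  assumes "0 < r"
  obtains \<delta> where "0 < \<delta>" "\<And>c. norm c < \<delta> \<Longrightarrow> fnorm (scal c x) \<le> r"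
proof -
  obtain k where k: "\<And>x. (\<And>n. n < k \<Longrightarrow> p n x \<le> r) \<Longrightarrow> fnorm x \<le> r"
    using fnorm_le_if_finitely_many[OF assms] by blast
  \<comment> \<open>A common bound for the first \<open>k\<close> seminorms of \<open>x\<close>; the summand \<open>1\<close> keeps it positive.\<close>
  define s where "s = 1 + (\<Sum>n<k. p n x)"
  have s: "0 < s" "p n x \<le> s" if "n < k" for n
  proof -
    have "p n x \<le> (\<Sum>n<k. p n x)"
      by (rule member_le_sum) (use that seminorm_nonneg[OF seminorm] in auto)
    then show "p n x \<le> s" by (simp add: s_def)
  qed (simp add: s_def sum_nonneg seminorm_nonneg[OF seminorm] add_pos_nonneg)
  have s0: "0 < s" by (simp add: s_def sum_nonneg seminorm_nonneg[OF seminorm] add_pos_nonneg)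
  show ?thesis
  proof
    show "0 < r / s" using assms s0 by simp
    fix c :: 'k assume c: "norm c < r / s"
    show "fnorm (scal c x) \<le> r"
    proof (rule k)
      fix n assume "n < k"
      have "p n (scal c x) \<le> r / s * s"
        unfolding seminorm_scale[OF seminorm]
        using c s(2)[OF \<open>n < k\<close>] seminorm_nonneg[OF seminorm, of n x] assms s0
        by (intro mult_mono) auto
      then show "p n (scal c x) \<le> r" using s0 by simp
    qed
  qed
qed

sublocale F: Metric_space UNIV "\<lambda>x y. fnorm (x - y)"
proof
  show "fnorm (x - y) = fnorm (y - x)" for x y using fnorm_minus[of "x - y"] by simp
  show "fnorm (x - y) = 0 \<longleftrightarrow> x = y" for x y using fnorm_eq_0_imp[of "x - y"] fnorm_0 by auto
  show "fnorm (x - z) \<le> fnorm (x - y) + fnorm (y - z)" for x y z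
    using fnorm_add[of "x - y" "y - z"] by simp
qed (rule fnorm_nonneg)

lemma openin_fnorm_iff:
  "openin F.mtopology S \<longleftrightarrow> (\<forall>x\<in>S. \<exists>r>0. \<forall>y. fnorm (y - x) < r \<longrightarrow> y \<in> S)"
  by (simp add: F.openin_mtopology subset_iff F.commute) blast

lemma openin_fnorm_ball: "openin F.mtopology {y. fnorm (y - x) < r}"
proof -
  have "F.mball x r = {y. fnorm (y - x) < r}" by (auto simp: F.commute)
  then show ?thesis using F.openin_mball[of x r] by simp
qed

text \<open>Continuity of scalar multiplication rests on \<open>b y - c x = b (y - x) + (b - c) x\<close>, where \<open>b\<close> stays bounded
near \<open>c\<close>.\<close>
lemma vector_space_topology_fnorm: "vector_space_topology scal F.mtopology"
proof -
  have "openin (prod_topology F.mtopology F.mtopology) {z. (case z of (x, y) \<Rightarrow> x + y) \<in> S}"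
    if S: "openin F.mtopology S" for S
    unfolding openin_prod_topology_alt
  proof (intro allI impI)
    fix x y assume "(x, y) \<in> {z. (case z of (x, y) \<Rightarrow> x + y) \<in> S}"
    then obtain r where r: "0 < r" "\<And>z. fnorm (z - (x + y)) < r \<Longrightarrow> z \<in> S"
      using S unfolding openin_fnorm_iff by auto
    have "x' + y' \<in> S" if "fnorm (x' - x) < r/2" "fnorm (y' - y) < r/2" for x' y'
    proof (rule r(2))
      have "fnorm ((x' + y') - (x + y)) \<le> fnorm (x' - x) + fnorm (y' - y)"
        using fnorm_add[of "x' - x" "y' - y"] by (simp add: algebra_simps)
      then show "fnorm ((x' + y') - (x + y)) < r" using that by simp
    qed
    then show "\<exists>U V. openin F.mtopology U \<and> openin F.mtopology V \<and> x \<in> U \<and> y \<in> V \<and>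
        U \<times> V \<subseteq> {z. (case z of (x, y) \<Rightarrow> x + y) \<in> S}"
      using openin_fnorm_ball[of x "r/2"] openin_fnorm_ball[of y "r/2"] r(1)
      by (intro exI[of _ "{z. fnorm (z - x) < r/2}"] exI[of _ "{z. fnorm (z - y) < r/2}"])
        (auto simp: fnorm_0)
  qed
  moreover have "openin (prod_topology euclidean F.mtopology) {z. (case z of (c, x) \<Rightarrow> scal c x) \<in> S}"
    if S: "openin F.mtopology S" for S
    unfolding openin_prod_topology_alt
  proof (intro allI impI)
    fix c x assume "(c, x) \<in> {z. (case z of (c, x) \<Rightarrow> scal c x) \<in> S}"
    then obtain r where r: "0 < r" "\<And>z. fnorm (z - scal c x) < r \<Longrightarrow> z \<in> S"
      using S unfolding openin_fnorm_iff by auto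
    obtain \<delta> where \<delta>: "0 < \<delta>" "\<And>b. norm b < \<delta> \<Longrightarrow> fnorm (scal b x) \<le> r/2"
      using fnorm_scale_small[of "r/2" x] r(1) by auto
    define K where "K = norm c + 1"
    have K: "1 \<le> K" by (simp add: K_def)
    have "scal b y \<in> S" if b: "b \<in> ball c (min 1 \<delta>)" and y: "fnorm (y - x) < r / (2 * K)" for b y
    proof (rule r(2))
      have nb: "norm (b - c) < 1" "norm (b - c) < \<delta>" using b by (auto simp: dist_norm norm_minus_commute)
      have "norm b \<le> K" using nb(1) norm_triangle_ineq[of "b - c" c] by (simp add: K_def)
      then have "fnorm (scal b (y - x)) \<le> K * fnorm (y - x)" using K by (rule fnorm_scale_le)
      also have "\<dots> < r/2" using y K by (simp add: field_simps)
      finally have "fnorm (scal b (y - x)) < r/2" .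
      moreover have "fnorm (scal (b - c) x) \<le> r/2" using nb(2) by (rule \<delta>(2))
      moreover have "scal b y - scal c x = scal b (y - x) + scal (b - c) x"
        by (simp add: scale_right_diff_distrib scale_left_diff_distrib)
      ultimately show "fnorm (scal b y - scal c x) < r"
        using fnorm_add[of "scal b (y - x)" "scal (b - c) x"] by simp
    qed
    then show "\<exists>U V. openin euclidean U \<and> openin F.mtopology V \<and> c \<in> U \<and> x \<in> V \<and>
        U \<times> V \<subseteq> {z. (case z of (c, x) \<Rightarrow> scal c x) \<in> S}"
      using openin_fnorm_ball[of x "r / (2 * K)"] r(1) \<delta>(1) K
      by (intro exI[of _ "ball c (min 1 \<delta>)"] exI[of _ "{z. fnorm (z - x) < r / (2 * K)}"])
        (auto simp: fnorm_0)
  qed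
  ultimately show ?thesis
    by (simp add: vector_space_topology_def continuous_map_def)
qed

lemma locally_convex_topology_fnorm: "locally_convex_topology scal F.mtopology"
  unfolding locally_convex_topology_def
proof (intro conjI allI impI)
  fix U assume "null_neighborhood F.mtopology U"
  then obtain r where r: "0 < r" "\<And>y. fnorm y < r \<Longrightarrow> y \<in> U"
    unfolding null_neighborhood_def openin_fnorm_iff by (metis diff_zero subsetD)
  show "\<exists>V. null_neighborhood F.mtopology V \<and> convex_wrt scal V \<and> V \<subseteq> U"
  proof (intro exI[of _ "{y. fnorm y < r}"] conjI)
    show "null_neighborhood F.mtopology {y. fnorm y < r}"
      unfolding null_neighborhood_def
      using openin_fnorm_ball[of 0 r] r(1) by (intro exI[of _ "{y. fnorm y < r}"]) (simp add: fnorm_0)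
    show "convex_wrt scal {y. fnorm y < r}"
      unfolding convex_wrt_def
    proof (intro ballI allI impI CollectI)
      fix x y and u v :: real
      assume xy: "x \<in> {y. fnorm y < r}" "y \<in> {y. fnorm y < r}" and uv: "0 \<le> u" "0 \<le> v" "u + v = 1"
      show "fnorm (scal (of_real u) x + scal (of_real v) y) < r"
        using fnorm_convex[OF uv, of x y] xy by simp
    qed
    show "{y. fnorm y < r} \<subseteq> U" using r(2) by blast
  qed
qed (rule vector_space_topology_fnorm)

lemma coarser_fnorm:
  assumes \<tau>: "vector_space_topology scal \<tau>"
    and p1: "\<And>n. null_neighborhood \<tau> {x. p n x \<le> 1}"
  shows "coarser F.mtopology \<tau>"
  unfolding coarser_def
proof (intro allI impI)
  interpret topological_scaling scal \<tau> by unfold_locales (rule \<tau>)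
  fix S assume S: "openin F.mtopology S"
  show "openin \<tau> S"
  proof (rule openinI_null_neighborhood)
    fix x assume "x \<in> S"
    then obtain r where r: "0 < r" "\<And>z. fnorm (z - x) < r \<Longrightarrow> z \<in> S"
      using S unfolding openin_fnorm_iff by auto
    obtain k where k: "\<And>x. (\<And>n. n < k \<Longrightarrow> p n x \<le> r/2) \<Longrightarrow> fnorm x \<le> r/2"
      using fnorm_le_if_finitely_many[of "r/2"] r(1) by auto
    have "null_neighborhood \<tau> (\<Inter>n<k. {x. p n x < r/2})"
      using r(1) by (intro null_neighborhood_INT null_neighborhood_seminorm_less[OF seminorm p1]) simp_all
    moreover have "x + y \<in> S" if "\<And>n. n < k \<Longrightarrow> p n y < r/2" for y
    proof (rule r(2))
      have "fnorm y \<le> r/2" by (rule k) (use that in \<open>simp add: less_imp_le\<close>)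
      then show "fnorm (x + y - x) < r" using r(1) by simp
    qed
    ultimately show "null_neighborhood \<tau> {y. x + y \<in> S}"
      by (elim null_neighborhood_mono) auto
  qed
qed

end

text \<open>The Minkowski functionals of the separating neighborhoods are separating seminorms because each support
function vanishes wherever the Minkowski functional does.\<close>
lemma countably_separated_imp_metrizable:
  fixes scal :: "'k::real_or_complex \<Rightarrow> 'a::ab_group_add \<Rightarrow> 'a"
  assumes vs: "vector_space scal" and \<tau>: "vector_space_topology scal \<tau>"
    and cs: "countably_separated scal \<tau>"
  obtains \<rho> where "locally_convex_topology scal \<rho>" "metrizable_space \<rho>" "coarser \<rho> \<tau>"
proof -
  interpret topological_scaling scal \<tau>
    using vs \<tau> by (simp add: topological_scaling_def topological_scaling_axioms_def
        normed_scaling_def)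
  obtain U where U: "\<And>n::nat. absolutely_convex scal (U n)" "\<And>n. null_neighborhood \<tau> (U n)"
      "(\<Inter>n. {x. support_function (polar scal \<tau> (U n)) x = 0}) = {0}"
    using cs unfolding countably_separated_def by blast
  define p where "p n = minkowski scal (U n)" for n
  have p: "seminorm_wrt scal (p n)" for n
    unfolding p_def using U(1) null_neighborhood_absorbing[OF U(2)] by (rule seminorm_minkowski)
  have p1: "null_neighborhood \<tau> {x. p n x \<le> 1}" for n
    by (rule null_neighborhood_mono[OF U(2)[of n]]) (auto simp: p_def minkowski_le_1)
  have S0: "support_function (polar scal \<tau> (U n)) x = 0" if 0: "p n x = 0" for n x
  proof (rule antisym)
    have "re_part (f x) \<le> 0" if f: "f \<in> polar scal \<tau> (U n)" for f
    proof (rule ccontr)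
      assume "\<not> re_part (f x) \<le> 0"
      then have pos: "0 < re_part (f x)" by simp
      \<comment> \<open>The multiple \<open>t x\<close> still lies in \<open>U n\<close>, but there the real part of \<open>f\<close> exceeds \<open>1\<close>.\<close>
      obtain t where t: "t > 1 / re_part (f x)" "0 < t" using pos
        by (meson gt_ex less_trans divide_pos_pos zero_less_one)
      have "p n (scal (of_real t) x) < 1" by (simp add: seminorm_scale[OF p] 0)
      then have "scal (of_real t) x \<in> U n"
        using minkowski_less_1_imp_mem[OF U(1) null_neighborhood_absorbing[OF U(2)]]
        unfolding p_def by blast
      then have "re_part (f (scal (of_real t) x)) \<le> 1" using f by (simp add: polar_def)
      moreover have "f (scal (of_real t) x) = of_real t * f x"
        using f by (simp add: polar_def continuous_dual_def Vector_Spaces.linear_iff)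
      then have "re_part (f (scal (of_real t) x)) = t * re_part (f x)"
        by (simp add: re_part_of_real_mult)
      ultimately show False using t pos by (simp add: field_simps)
    qed
    then show "support_function (polar scal \<tau> (U n)) x \<le> 0"
      unfolding support_function_def by (intro SUP_least) (simp add: zero_ereal_def)
    have "ereal (re_part (0 :: 'k)) \<le> support_function (polar scal \<tau> (U n)) x"
      unfolding support_function_def using zero_in_polar[OF vs] by (rule SUP_upper2) simp
    then show "0 \<le> support_function (polar scal \<tau> (U n)) x"
      by (simp add: re_part_0 zero_ereal_def)
  qed
  interpret separating_seminorms scal p
  proof
    show "seminorm_wrt scal (p n)" for n by (rule p)
    show "x = 0" if "\<And>n. p n x = 0" for x
    proof -
      have "x \<in> (\<Inter>n. {x. support_function (polar scal \<tau> (U n)) x = 0})" using S0 that by simp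
      then show ?thesis using U(3) by simp
    qed
  qed
  show ?thesis
    using locally_convex_topology_fnorm F.metrizable_space_mtopology coarser_fnorm[OF \<tau> p1]
    by (rule that)
qed

theorem theorem3p2:
  fixes scal :: "'k::real_or_complex \<Rightarrow> 'a::ab_group_add \<Rightarrow> 'a"
    and \<tau> :: "'a topology"
  assumes "vector_space scal"
    and "locally_convex_topology scal \<tau>"
    and "Hausdorff_space \<tau>"
  shows "(countably_separated scal \<tau> \<longleftrightarrow>
            (\<exists>\<rho>. topspace \<rho> = UNIV \<and> metrizable_space \<rho> \<and> coarser \<rho> \<tau>)) \<and>
         (countably_separated scal \<tau> \<longrightarrow>
            (\<exists>\<rho>. locally_convex_topology scal \<rho> \<and> metrizable_space \<rho> \<and> coarser \<rho> \<tau>))"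
proof -
  have vst: "vector_space_topology scal \<tau>"
    using assms(2) by (simp add: locally_convex_topology_def)
  have lc: "\<exists>\<rho>. locally_convex_topology scal \<rho> \<and> metrizable_space \<rho> \<and> coarser \<rho> \<tau>"
    if "countably_separated scal \<tau>"
    using assms(1) vst that by (rule countably_separated_imp_metrizable) blast
  moreover have "\<exists>\<rho>. topspace \<rho> = UNIV \<and> metrizable_space \<rho> \<and> coarser \<rho> \<tau>"
    if "countably_separated scal \<tau>"
    using lc[OF that] by (auto simp: locally_convex_topology_def vector_space_topology_def)
  moreover have "countably_separated scal \<tau>"
    if \<rho>: "topspace \<rho> = UNIV" "metrizable_space \<rho>" "coarser \<rho> \<tau>" for \<rho>
  proof -
    obtain B :: "nat \<Rightarrow> 'a set" where B: "\<And>n. openin \<rho> (B n)" "(\<Inter>n. B n) = {0}"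
      using metrizable_ex_separating_open_sequence[OF \<rho>(2), of 0] \<rho>(1) by auto
    have "null_neighborhood \<tau> (B n)" for n
      using B \<rho>(3) unfolding null_neighborhood_def coarser_def by blast
    then show ?thesis using B(2) by (rule countably_separatedI[OF assms(1,2)])
  qed
  ultimately show ?thesis by blast
qed

end
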